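(* Let $f:\mathbb{R}^{n_1}\to\mathbb{R}$ and $g:\mathbb{R}^{n_2}\to\mathbb{R}$ be closed convex functions, $\mathcal{X}\subseteq\mathbb{R}^{n_1}$ and $\mathcal{Y}\subseteq\mathbb{R}^{n_2}$ closed convex sets, $A\in\mathbb{R}^{m\times n_1}$, $B\in\mathbb{R}^{m\times n_2}$, $b\in\mathbb{R}^m$, and $\beta,\tau,\eta>0$. Let $\Omega:=\mathcal{X}\times\mathcal{Y}\times\mathbb{R}^m$ and, for $w=(x,y,p)$, let $\theta(w):=f(x)+g(y)$ and $$F(w):=\begin{pmatrix} -A^Tp \\ -B^Tp \\ {A}x+By-b \end{pmatrix}.$$ Given $w^k=(x^k,y^k,p^k)\in\Omega$, the point $w^{k+1}=(x^{k+1},y^{k+1},p^{k+1})$ generated from $w^k$ by one iteration of the linearized ADMM (defined in the context) satisfies $$w^{k+1}\in\Omega,\qquad \theta(w)-\theta(w^{k+1})+\big\langle w-w^{k+1},\,F(w^{k+1})+G(w^{k+1}-w^k)\big\rangle\ge0\quad\text{for all } w\in\Omega,$$ where $$G=\begin{pmatrix}\beta\left(\frac1\tau I-A^TA\right)&0&0\\0&\frac\beta\eta I&-B^T\\0&-B&\frac1\beta I\end{pmatrix}$$ and $I$ denotes the identity matrix of appropriate size.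
   Context: The underlying optimization problem is $$\min_{x,y}\{f(x)+g(y):\ Ax+By=b,\ x\in\mathcal{X},\ y\in\mathcal{Y}\},$$ and it is a standing assumption that its set of KKT points is nonempty. Linearized ADMM (in "$x$-$p$-$y$" order): given $(x^k,y^k,p^k)$, one iteration computes $$u^k=A^T(Ax^k+By^k-b),$$ $$x^{k+1}=\arg\min_{x\in\mathcal{X}}\ f(x)-\langle p^k,Ax\rangle+\frac{\beta}{2\tau}\|x-(x^k-\tau u^k)\|^2,$$ $$p^{k+1}=p^k-\beta(Ax^{k+1}+By^k-b),$$ $$v^k=B^T(Ax^{k+1}+By^k-b),$$ $$y^{k+1}=\arg\min_{y\in\mathcal{Y}}\ g(y)-\langle p^{k+1},By\rangle+\frac{\beta}{2\eta}\|y-(y^k-\eta v^k)\|^2 .$$ Here $\langle\cdot,\cdot\rangle$ and $\|\cdot\|$ are the standard inner product and $\ell_2$ norm. *)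

theory Defs
  imports "HOL-Analysis.Analysis"
begin

text \<open>A closed function is one whose epigraph is a closed set.\<close>

definition closed_convex_fun :: "('a::euclidean_space \<Rightarrow> real) \<Rightarrow> bool" where
  "closed_convex_fun f \<longleftrightarrow> convex_on UNIV f \<and> closed (epigraph UNIV f)"

definition subdifferential :: "('a::euclidean_space \<Rightarrow> real) \<Rightarrow> 'a \<Rightarrow> 'a set" where
  "subdifferential f x = {s. \<forall>z. f z \<ge> f x + s \<bullet> (z - x)}"

text \<open>Only meaningful for \<open>x \<in> S\<close>.\<close>

definition normal_cone :: "'a::euclidean_space set \<Rightarrow> 'a \<Rightarrow> 'a set" where
  "normal_cone S x = {s. \<forall>z\<in>S. s \<bullet> (z - x) \<le> 0}"

text \<open>
  KKT points of: minimise \<open>f x + g y\<close> subject to \<open>A x + B y = b\<close>, \<open>x \<in> X\<close>, \<open>y \<in> Y\<close>.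
  The multiplier \<open>p\<close> enters the Lagrangian as \<open>f x + g y - p \<bullet> (A x + B y - b)\<close>, so stationarity
  reads \<open>A\<^sup>T p \<in> \<partial>f x + N\<^sub>X x\<close> and \<open>B\<^sup>T p \<in> \<partial>g y + N\<^sub>Y y\<close>.
\<close>

definition kkt_points ::
  "(real^'n1 \<Rightarrow> real) \<Rightarrow> (real^'n2 \<Rightarrow> real) \<Rightarrow> (real^'n1) set \<Rightarrow> (real^'n2) set \<Rightarrow>
   real^'n1^'m \<Rightarrow> real^'n2^'m \<Rightarrow> real^'m \<Rightarrow> ((real^'n1) \<times> (real^'n2) \<times> (real^'m)) set" where
  "kkt_points f g X Y A B b = {(x, y, p). x \<in> X \<and> y \<in> Y \<and> A *v x + B *v y = b \<and>
     (\<exists>s\<in>subdifferential f x. \<exists>t\<in>normal_cone X x. transpose A *v p = s + t) \<and>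
     (\<exists>s\<in>subdifferential g y. \<exists>t\<in>normal_cone Y y. transpose B *v p = s + t)}"

text \<open>
  One iteration, as a relation between the current and the next iterate; \<open>is_arg_min h P z\<close> says
  that \<open>z\<close> minimises \<open>h\<close> among the points satisfying \<open>P\<close>.
\<close>

definition ladmm_step ::
  "(real^'n1 \<Rightarrow> real) \<Rightarrow> (real^'n2 \<Rightarrow> real) \<Rightarrow> (real^'n1) set \<Rightarrow> (real^'n2) set \<Rightarrow>
   real^'n1^'m \<Rightarrow> real^'n2^'m \<Rightarrow> real^'m \<Rightarrow> real \<Rightarrow> real \<Rightarrow> real \<Rightarrow>
   (real^'n1) \<times> (real^'n2) \<times> (real^'m) \<Rightarrow> (real^'n1) \<times> (real^'n2) \<times> (real^'m) \<Rightarrow> bool" where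
  "ladmm_step f g X Y A B b \<beta> \<tau> \<eta> = (\<lambda>(x, y, p) (x', y', p').
     let u = transpose A *v (A *v x + B *v y - b);
         v = transpose B *v (A *v x' + B *v y - b)
     in is_arg_min (\<lambda>z. f z - p \<bullet> (A *v z) + \<beta> / (2 * \<tau>) * (norm (z - (x - \<tau> *\<^sub>R u)))\<^sup>2)
          (\<lambda>z. z \<in> X) x' \<and>
        p' = p - \<beta> *\<^sub>R (A *v x' + B *v y - b) \<and>
        is_arg_min (\<lambda>z. g z - p' \<bullet> (B *v z) + \<beta> / (2 * \<eta>) * (norm (z - (y - \<eta> *\<^sub>R v)))\<^sup>2)
          (\<lambda>z. z \<in> Y) y')"

definition theta ::
  "(real^'n1 \<Rightarrow> real) \<Rightarrow> (real^'n2 \<Rightarrow> real) \<Rightarrow> (real^'n1) \<times> (real^'n2) \<times> (real^'m) \<Rightarrow> real" where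
  "theta f g = (\<lambda>(x, y, p). f x + g y)"

definition F_op ::
  "real^'n1^'m \<Rightarrow> real^'n2^'m \<Rightarrow> real^'m \<Rightarrow>
   (real^'n1) \<times> (real^'n2) \<times> (real^'m) \<Rightarrow> (real^'n1) \<times> (real^'n2) \<times> (real^'m)" where
  "F_op A B b = (\<lambda>(x, y, p).
     (- (transpose A *v p), - (transpose B *v p), A *v x + B *v y - b))"

text \<open>The block matrix \<open>G\<close>, given by its action on the product space, one component per block row.\<close>

definition G_op ::
  "real^'n1^'m \<Rightarrow> real^'n2^'m \<Rightarrow> real \<Rightarrow> real \<Rightarrow> real \<Rightarrow>
   (real^'n1) \<times> (real^'n2) \<times> (real^'m) \<Rightarrow> (real^'n1) \<times> (real^'n2) \<times> (real^'m)" where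
  "G_op A B \<beta> \<tau> \<eta> = (\<lambda>(x, y, p).
     ((\<beta> *\<^sub>R ((1 / \<tau>) *\<^sub>R mat 1 - transpose A ** A)) *v x,
      ((\<beta> / \<eta>) *\<^sub>R mat 1) *v y + (- transpose B) *v p,
      (- B) *v y + ((1 / \<beta>) *\<^sub>R mat 1) *v p))"

end

theory Submission
  imports Defs
begin

text \<open>
  The first-order optimality condition of each proximal subproblem is a variational inequality.
  Substituting the multiplier update, i.e. \<open>p = p' + \<beta> (A x' + B y - b)\<close> in the \<open>x\<close>-inequality and
  \<open>\<beta> (A x' + B y - b) = p - p'\<close> in the \<open>y\<close>-inequality, turns their linear terms into the first two
  blocks of \<open>F w' + G (w' - w)\<close>; the third block vanishes because it is the multiplier update itself.
\<close>

text \<open>A minimiser cannot be improved by moving a fraction \<open>t\<close> of the way towards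
  \<open>z\<close>. Convexity bounds the change of \<open>h\<close> by
  \<open>t * (h z - h x)\<close>, so dividing by \<open>t\<close> and letting \<open>t\<close> tend
  to 0 from the right yields the inequality without any subgradient of \<open>h\<close>.\<close>

lemma prox_variational_inequality:
  fixes h :: "'a::real_inner \<Rightarrow> real"
  assumes h: "convex_on S h"
    and min: "is_arg_min (\<lambda>z. h z - q \<bullet> z + c / 2 * (norm (z - a))\<^sup>2) (\<lambda>z. z \<in> S) x"
    and z: "z \<in> S"
  shows "h z - h x + (z - x) \<bullet> (c *\<^sub>R (x - a) - q) \<ge> 0"
proof -
  define d where "d = z - x"
  define D where "D = h z - h x + d \<bullet> (c *\<^sub>R (x - a) - q)"
  have x: "x \<in> S"
    using min by (simp add: is_arg_min_def)
  \<comment> \<open>\<open>D\<close> collects the terms of first order in \<open>t\<close>; the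
    remainder is the \<open>t\<^sup>2\<close> term of the expanded square after one factor
    \<open>t\<close> is divided out.\<close>
  have le: "0 \<le> D + t * (c / 2 * (norm d)\<^sup>2)" if t: "0 < t" "t < 1" for t :: real
  proof -
    have comb: "x + t *\<^sub>R d = (1 - t) *\<^sub>R x + t *\<^sub>R z"
      by (simp add: d_def algebra_simps)
    have "x + t *\<^sub>R d \<in> S"
      unfolding comb using convex_on_imp_convex[OF h] x z t by (simp add: convexD_alt)
    then have "h x - q \<bullet> x + c / 2 * (norm (x - a))\<^sup>2
        \<le> h (x + t *\<^sub>R d) - q \<bullet> (x + t *\<^sub>R d) + c / 2 * (norm (x + t *\<^sub>R d - a))\<^sup>2"
      using min by (force simp: is_arg_min_def not_less)
    moreover have "h (x + t *\<^sub>R d) \<le> (1 - t) * h x + t * h z"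
      unfolding comb using convex_onD[OF h, of t x z] x z t by simp
    moreover have sq: "(norm (x + t *\<^sub>R d - a))\<^sup>2
        = (norm (x - a))\<^sup>2 + 2 * t * (d \<bullet> (x - a)) + t\<^sup>2 * (norm d)\<^sup>2"
      unfolding power2_norm_eq_inner
      by (simp add: algebra_simps inner_commute power2_eq_square)
    ultimately have "0 \<le> t * (D + t * (c / 2 * (norm d)\<^sup>2))"
      unfolding sq by (simp add: D_def algebra_simps inner_commute power2_eq_square)
    then show ?thesis
      using t by (simp add: zero_le_mult_iff)
  qed
  have "((\<lambda>t. D + t * (c / 2 * (norm d)\<^sup>2)) \<longlongrightarrow> D + 0 * (c / 2 * (norm d)\<^sup>2)) (at_right 0)"
    by (intro tendsto_intros)
  moreover have "\<forall>\<^sub>F t in at_right 0. 0 \<le> D + t * (c / 2 * (norm d)\<^sup>2)"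
    using le by (auto simp: eventually_at_right_field intro!: exI[of _ 1])
  ultimately have "0 \<le> D + 0 * (c / 2 * (norm d)\<^sup>2)"
    by (rule tendsto_lowerbound) simp
  then show ?thesis
    by (simp add: D_def d_def)
qed

lemma uminus_matrix_vector_mult: "(- M) *v x = - (M *v (x :: 'a::ring_1 ^ 'n))"
  by (simp add: matrix_vector_mult_def vec_eq_iff sum_negf)

theorem theorem3:
  fixes f :: "real^'n1 \<Rightarrow> real" and g :: "real^'n2 \<Rightarrow> real"
    and X :: "(real^'n1) set" and Y :: "(real^'n2) set"
    and A :: "real^'n1^'m" and B :: "real^'n2^'m" and b :: "real^'m"
    and \<beta> \<tau> \<eta> :: real
    and \<Omega> :: "((real^'n1) \<times> (real^'n2) \<times> (real^'m)) set"
    and wk wk1 :: "(real^'n1) \<times> (real^'n2) \<times> (real^'m)"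
  assumes "closed_convex_fun f" and "closed_convex_fun g"
    and "closed X" and "convex X" and "closed Y" and "convex Y"
    and "\<beta> > 0" and "\<tau> > 0" and "\<eta> > 0"
    and "kkt_points f g X Y A B b \<noteq> {}"
    and "\<Omega> = X \<times> Y \<times> UNIV"
    and "wk \<in> \<Omega>"
    and "ladmm_step f g X Y A B b \<beta> \<tau> \<eta> wk wk1"
  shows "wk1 \<in> \<Omega> \<and>
    (\<forall>w\<in>\<Omega>. theta f g w - theta f g wk1
       + (w - wk1) \<bullet> (F_op A B b wk1 + G_op A B \<beta> \<tau> \<eta> (wk1 - wk)) \<ge> 0)"
proof -
  have conv: "convex_on X f" "convex_on Y g"
    using assms by (auto simp: closed_convex_fun_def intro: convex_on_subset)
  obtain x y p where wk: "wk = (x, y, p)" by (cases wk)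
  obtain x' y' p' where wk1: "wk1 = (x', y', p')" by (cases wk1)
  define r where "r = A *v x' + B *v y - b"
  define u where "u = transpose A *v (A *v x + B *v y - b)"
  have adjoint: "q \<bullet> (M *v z) = (transpose M *v q) \<bullet> z"
    for q :: "real^'k" and M :: "real^'j^'k" and z
    by (simp add: dot_lmul_matrix)
  \<comment> \<open>Transposing \<open>A\<close> and \<open>B\<close> onto the multipliers gives the
    linear term the form \<open>q \<bullet> z\<close>; the proximal weights become
    \<open>c = \<beta> / \<tau>\<close> and \<open>c = \<beta> / \<eta>\<close>.\<close>
  from assms have
    minx: "is_arg_min (\<lambda>z. f z - (transpose A *v p) \<bullet> z + \<beta> / \<tau> / 2 * (norm (z - (x - \<tau> *\<^sub>R u)))\<^sup>2)
            (\<lambda>z. z \<in> X) x'"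
    and p': "p' = p - \<beta> *\<^sub>R r"
    and miny: "is_arg_min (\<lambda>z. g z - (transpose B *v p') \<bullet> z
                + \<beta> / \<eta> / 2 * (norm (z - (y - \<eta> *\<^sub>R (transpose B *v r))))\<^sup>2) (\<lambda>z. z \<in> Y) y'"
    by (auto simp: ladmm_step_def wk wk1 Let_def u_def r_def adjoint mult.commute
        del: vector_transpose_matrix transpose_matrix_vector)
  note linear = matrix_vector_mult_diff_distrib matrix_vector_right_distrib
    matrix_vector_mult_scaleR scaleR_matrix_vector_assoc[symmetric]
    matrix_vector_mult_diff_rdistrib uminus_matrix_vector_mult
    matrix_vector_mul_assoc[symmetric]
  \<comment> \<open>Both residuals contain the same \<open>B *v y\<close>, so \<open>u\<close> minus
    \<open>transpose A *v r\<close> is \<open>transpose A *v (A *v (x - x'))\<close>: this is where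
    the block \<open>- transpose A ** A\<close> comes from.\<close>
  have blockx: "(\<beta> / \<tau>) *\<^sub>R (x' - (x - \<tau> *\<^sub>R u)) - transpose A *v p
      = - (transpose A *v p') + (\<beta> *\<^sub>R ((1 / \<tau>) *\<^sub>R mat 1 - transpose A ** A)) *v (x' - x)"
    using \<open>\<tau> > 0\<close>
    by (simp add: p' r_def u_def linear algebra_simps del: transpose_matrix_vector)
  have blocky: "(\<beta> / \<eta>) *\<^sub>R (y' - (y - \<eta> *\<^sub>R (transpose B *v r))) - transpose B *v p'
      = - (transpose B *v p') + (((\<beta> / \<eta>) *\<^sub>R mat 1) *v (y' - y) + (- transpose B) *v (p' - p))"
    using \<open>\<eta> > 0\<close>
    by (simp add: p' linear linear_neg[OF matrix_vector_mul_linear] algebra_simps del: transpose_matrix_vector)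
  \<comment> \<open>The term in \<open>y' - y\<close> turns \<open>B *v y'\<close> back into
    \<open>B *v y\<close>, which leaves \<open>r\<close>, and \<open>p' - p\<close> divided by
    \<open>\<beta>\<close> is \<open>- r\<close>.\<close>
  have blockp: "A *v x' + B *v y' - b + ((- B) *v (y' - y) + ((1 / \<beta>) *\<^sub>R mat 1) *v (p' - p)) = 0"
    using \<open>\<beta> > 0\<close> by (simp add: p' r_def linear algebra_simps)
  have FG: "F_op A B b wk1 + G_op A B \<beta> \<tau> \<eta> (wk1 - wk)
      = ((\<beta> / \<tau>) *\<^sub>R (x' - (x - \<tau> *\<^sub>R u)) - transpose A *v p,
         (\<beta> / \<eta>) *\<^sub>R (y' - (y - \<eta> *\<^sub>R (transpose B *v r))) - transpose B *v p', 0)"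
    unfolding blockx blocky blockp[symmetric] by (simp add: F_op_def G_op_def wk wk1)
  have "theta f g w - theta f g wk1
      + (w - wk1) \<bullet> (F_op A B b wk1 + G_op A B \<beta> \<tau> \<eta> (wk1 - wk)) \<ge> 0"
    if w_in: "w \<in> \<Omega>" for w
  proof -
    obtain z1 z2 q where w: "w = (z1, z2, q)" "z1 \<in> X" "z2 \<in> Y"
      using w_in \<open>\<Omega> = X \<times> Y \<times> UNIV\<close> by auto
    show ?thesis
      \<comment> \<open>The inner product splits over the three blocks and the last one is 0 for
        every \<open>q\<close>, so the claim is the sum of the two inequalities.\<close>
      using prox_variational_inequality[OF conv(1) minx w(2)]
        prox_variational_inequality[OF conv(2) miny w(3)]
      unfolding FG by (simp add: w(1) wk1 theta_def)
  qed
  moreover have "wk1 \<in> \<Omega>"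
    using minx miny by (simp add: assms wk1 is_arg_min_def)
  ultimately show ?thesis
    by blast
qed

end
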